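(* Let $X$ be a chaos eigenfunction of order $p$ (with eigenvalue $\lambda_p$) with respect to $-\mathbf{L}$, assume that $\lambda_{2p}\le 2\lambda_p$, and set $Y=X+\nu$ for some $\nu>0$. Then $$\int_E\left(\Gamma(Y)-\lambda_pY\right)^2d\mu\le\frac{\lambda_p^2}{3}\left(m_4(X)-6\,m_3(X)+6(1-\nu)\,m_2(X)+3\nu^2\right).$$
   Context: $(E,\mathcal{F},\mu)$ is a probability space and $-\mathbf{L}$ is a symmetric Markov generator with state space $E$ and invariant probability measure $\mu$: $\mathbf{L}$ is a (possibly unbounded) self-adjoint linear operator on the real space $L^2(E,\mu)$ with $\mathbf{L}1=0$. $-\mathbf{L}$ has discrete spectrum $\{\lambda_k\}_{k\ge 0}$, $0=\lambda_0<\lambda_1<\lambda_2<\cdots$, and $L^2(E,\mu)=\bigoplus_{k=0}^\infty\mathrm{Ker}(\mathbf{L}+\lambda_k\mathbf{Id})$ (orthogonal sum). The carré du champ operator is $\Gamma(X,Y)=\frac12(\mathbf{L}(XY)-X\mathbf{L}Y-Y\mathbf{L}X)$, $\Gamma(X)=\Gamma(X,X)$. It satisfies the integration by parts formula $\int_E\Gamma(X,Y)\,d\mu=-\int_E X\mathbf{L}Y\,d\mu=-\int_E Y\mathbf{L}X\,d\mu$. $\mathbf{L}$ is assumed diffusive: for smooth $\phi:\mathbb{R}\to\mathbb{R}$, $\mathbf{L}\phi(X)=\phi'(X)\mathbf{L}X+\phi''(X)\Gamma(X)$; equivalently $\Gamma(\phi(X),X)=\phi'(X)\Gamma(X)$ (and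 $\Gamma(\phi(X))=\phi'(X)^2\Gamma(X)$). The integration by parts formula $\int_E\Gamma(X,Y)\,d\mu=-\int_E X\mathbf{L}Y\,d\mu=-\int_E Y\mathbf{L}X\,d\mu$, the diffusion identity $\mathbf{L}\phi(X)=\phi'(X)\mathbf{L}X+\phi''(X)\Gamma(X)$, and the derivation identities $\Gamma(\phi(X),X)=\phi'(X)\Gamma(X)$ and $\Gamma(\phi(X))=\phi'(X)^2\Gamma(X)$ are assumed for all functions for which the expressions make sense, in particular for $X$ an eigenfunction of $\mathbf{L}$ and $\phi$ a polynomial or a bounded smooth function with bounded derivatives. The eigenspaces are assumed hypercontractive: for each $k$ and each $r\ge 2$ there is a finite constant $C_{k,r}$ with $\|X\|_{L^r(E,\mu)}\le C_{k,r}\|X\|_{L^2(E,\mu)}$ for all $X\in\mathrm{Ker}(\mathbf{L}+\lambda_k\mathbf{Id})$. Chaos eigenfunction: $X$ is a chaos eigenfunction of order $p$ if $\mathbf{L}X=-\lambda_pX$ and $X^2\in\bigoplus_{k=0}^{2p}\mathrm{Ker}(\mathbf{L}+\lambda_k\mathbf{Id})$. Moments: $m_k(X)=\int_E X^k\,d\mu$. *)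

theory Defs
  imports "HOL-Probability.Probability"
begin

text \<open>
  Elements of \<open>L\<^sup>2(E,\<mu>)\<close> are represented by square-integrable functions, and identities between
  them are understood almost everywhere.  An unbounded operator is a pair of a domain \<open>D\<close> and a
  map \<open>L\<close> that is relevant only on \<open>D\<close>.
\<close>

definition L2 :: "'a measure \<Rightarrow> ('a \<Rightarrow> real) set" where
  "L2 M = {X \<in> borel_measurable M. integrable M (\<lambda>x. (X x)\<^sup>2)}"

definition l2_norm :: "'a measure \<Rightarrow> ('a \<Rightarrow> real) \<Rightarrow> real" where
  "l2_norm M X = sqrt (\<integral>x. (X x)\<^sup>2 \<partial>M)"

definition l2_operator ::
    "'a measure \<Rightarrow> ('a \<Rightarrow> real) set \<Rightarrow> (('a \<Rightarrow> real) \<Rightarrow> 'a \<Rightarrow> real) \<Rightarrow> bool" where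
  "l2_operator M D L \<longleftrightarrow>
     D \<subseteq> L2 M \<and> (\<forall>X\<in>D. L X \<in> L2 M) \<and>
     (\<forall>X\<in>D. \<forall>Y\<in>borel_measurable M. (AE x in M. X x = Y x) \<longrightarrow>
        Y \<in> D \<and> (AE x in M. L X x = L Y x)) \<and>
     (\<forall>X\<in>D. \<forall>Y\<in>D. \<forall>a b. (\<lambda>x. a * X x + b * Y x) \<in> D \<and>
        (AE x in M. L (\<lambda>x. a * X x + b * Y x) x = a * L X x + b * L Y x))"

definition densely_defined :: "'a measure \<Rightarrow> ('a \<Rightarrow> real) set \<Rightarrow> bool" where
  "densely_defined M D \<longleftrightarrow>
     (\<forall>X\<in>L2 M. \<forall>e>0. \<exists>Y\<in>D. l2_norm M (\<lambda>x. X x - Y x) < e)"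

text \<open>\<open>Y\<close> is in the domain of the adjoint, with \<open>L* Y = Z\<close>.\<close>

definition adjoint_graph ::
    "'a measure \<Rightarrow> ('a \<Rightarrow> real) set \<Rightarrow> (('a \<Rightarrow> real) \<Rightarrow> 'a \<Rightarrow> real) \<Rightarrow>
     ('a \<Rightarrow> real) \<Rightarrow> ('a \<Rightarrow> real) \<Rightarrow> bool" where
  "adjoint_graph M D L Y Z \<longleftrightarrow> Y \<in> L2 M \<and> Z \<in> L2 M \<and>
     (\<forall>X\<in>D. (\<integral>x. L X x * Y x \<partial>M) = (\<integral>x. X x * Z x \<partial>M))"

text \<open>\<open>L = L*\<close>, including equality of the domains (not merely symmetry).\<close>

definition self_adjoint_operator ::
    "'a measure \<Rightarrow> ('a \<Rightarrow> real) set \<Rightarrow> (('a \<Rightarrow> real) \<Rightarrow> 'a \<Rightarrow> real) \<Rightarrow> bool" where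
  "self_adjoint_operator M D L \<longleftrightarrow> l2_operator M D L \<and> densely_defined M D \<and>
     (\<forall>Y Z. adjoint_graph M D L Y Z \<longleftrightarrow>
        Y \<in> D \<and> Z \<in> L2 M \<and> (AE x in M. L Y x = Z x))"

definition annihilates_one ::
    "'a measure \<Rightarrow> ('a \<Rightarrow> real) set \<Rightarrow> (('a \<Rightarrow> real) \<Rightarrow> 'a \<Rightarrow> real) \<Rightarrow> bool" where
  "annihilates_one M D L \<longleftrightarrow> (\<lambda>_. 1) \<in> D \<and> (AE x in M. L (\<lambda>_. 1) x = 0)"

text \<open>\<open>T - r Id\<close> maps the domain bijectively onto \<open>L\<^sup>2\<close> with bounded inverse; the norm bound
  includes injectivity.  Only real \<open>r\<close> are considered, which loses nothing for self-adjoint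
  operators.\<close>

definition l2_resolvent_set ::
    "'a measure \<Rightarrow> ('a \<Rightarrow> real) set \<Rightarrow> (('a \<Rightarrow> real) \<Rightarrow> 'a \<Rightarrow> real) \<Rightarrow> real set" where
  "l2_resolvent_set M D T =
     {r. (\<forall>Z\<in>L2 M. \<exists>X\<in>D. AE x in M. T X x - r * X x = Z x) \<and>
         (\<exists>C. \<forall>X\<in>D. l2_norm M X \<le> C * l2_norm M (\<lambda>x. T X x - r * X x))}"

definition l2_spectrum ::
    "'a measure \<Rightarrow> ('a \<Rightarrow> real) set \<Rightarrow> (('a \<Rightarrow> real) \<Rightarrow> 'a \<Rightarrow> real) \<Rightarrow> real set" where
  "l2_spectrum M D T = - l2_resolvent_set M D T"

text \<open>\<open>Ker(L + r Id)\<close>\<close>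

definition eigenspace ::
    "'a measure \<Rightarrow> ('a \<Rightarrow> real) set \<Rightarrow> (('a \<Rightarrow> real) \<Rightarrow> 'a \<Rightarrow> real) \<Rightarrow> real \<Rightarrow>
     ('a \<Rightarrow> real) set" where
  "eigenspace M D L r = {X \<in> D. AE x in M. L X x + r * X x = 0}"

text \<open>The Hilbert space direct sum: pairwise orthogonality, and every element of \<open>L\<^sup>2\<close> is the
  norm limit of a series of eigenfunctions.\<close>

definition orthogonal_decomposition ::
    "'a measure \<Rightarrow> ('a \<Rightarrow> real) set \<Rightarrow> (('a \<Rightarrow> real) \<Rightarrow> 'a \<Rightarrow> real) \<Rightarrow> (nat \<Rightarrow> real) \<Rightarrow> bool" where
  "orthogonal_decomposition M D L lam \<longleftrightarrow>
     (\<forall>j k. j \<noteq> k \<longrightarrow> (\<forall>X\<in>eigenspace M D L (lam j). \<forall>Y\<in>eigenspace M D L (lam k).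
        (\<integral>x. X x * Y x \<partial>M) = 0)) \<and>
     (\<forall>Z\<in>L2 M. \<exists>W. (\<forall>k. W k \<in> eigenspace M D L (lam k)) \<and>
        (\<lambda>n. l2_norm M (\<lambda>x. Z x - (\<Sum>k<n. W k x))) \<longlonglongrightarrow> 0)"

text \<open>Since the spectrum is a closed set, equality with the range of the strictly increasing
  sequence \<open>lam\<close> forces \<open>lam\<close> to be unbounded, so the spectrum has no accumulation point.
  Discreteness does not include finite multiplicity of the eigenvalues.\<close>

definition has_discrete_spectrum ::
    "'a measure \<Rightarrow> ('a \<Rightarrow> real) set \<Rightarrow> (('a \<Rightarrow> real) \<Rightarrow> 'a \<Rightarrow> real) \<Rightarrow> (nat \<Rightarrow> real) \<Rightarrow> bool" where
  "has_discrete_spectrum M D L lam \<longleftrightarrow> lam 0 = 0 \<and> strict_mono lam \<and>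
     l2_spectrum M D (\<lambda>X x. - L X x) = range lam \<and>
     orthogonal_decomposition M D L lam"

definition carre_du_champ ::
    "(('a \<Rightarrow> real) \<Rightarrow> 'a \<Rightarrow> real) \<Rightarrow> ('a \<Rightarrow> real) \<Rightarrow> ('a \<Rightarrow> real) \<Rightarrow> 'a \<Rightarrow> real" where
  "carre_du_champ L X Y =
     (\<lambda>x. (L (\<lambda>y. X y * Y y) x - X x * L Y x - Y x * L X x) / 2)"

text \<open>The expression \<open>\<Gamma>(X,Y)\<close> makes sense.\<close>

definition carre_dom :: "('a \<Rightarrow> real) set \<Rightarrow> ('a \<Rightarrow> real) \<Rightarrow> ('a \<Rightarrow> real) \<Rightarrow> bool" where
  "carre_dom D X Y \<longleftrightarrow> X \<in> D \<and> Y \<in> D \<and> (\<lambda>x. X x * Y x) \<in> D"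

definition integration_by_parts ::
    "'a measure \<Rightarrow> ('a \<Rightarrow> real) set \<Rightarrow> (('a \<Rightarrow> real) \<Rightarrow> 'a \<Rightarrow> real) \<Rightarrow> bool" where
  "integration_by_parts M D L \<longleftrightarrow> (\<forall>X Y. carre_dom D X Y \<longrightarrow>
     (\<integral>x. carre_du_champ L X Y x \<partial>M) = - (\<integral>x. X x * L Y x \<partial>M) \<and>
     (\<integral>x. carre_du_champ L X Y x \<partial>M) = - (\<integral>x. Y x * L X x \<partial>M))"

definition smooth :: "(real \<Rightarrow> real) \<Rightarrow> bool" where
  "smooth \<phi> \<longleftrightarrow> (\<forall>n t. (deriv ^^ n) \<phi> differentiable (at t))"

text \<open>Polynomials, and bounded smooth functions with bounded derivatives (\<open>n = 0\<close> is the
  boundedness of \<open>\<phi>\<close> itself).\<close>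

definition test_function :: "(real \<Rightarrow> real) \<Rightarrow> bool" where
  "test_function \<phi> \<longleftrightarrow>
     \<phi> \<in> range poly \<or> (smooth \<phi> \<and> (\<forall>n. bounded (range ((deriv ^^ n) \<phi>))))"

text \<open>The identities are required whenever all expressions occurring in them make sense.\<close>

definition diffusive ::
    "'a measure \<Rightarrow> ('a \<Rightarrow> real) set \<Rightarrow> (('a \<Rightarrow> real) \<Rightarrow> 'a \<Rightarrow> real) \<Rightarrow> bool" where
  "diffusive M D L \<longleftrightarrow> (\<forall>\<phi> X. smooth \<phi> \<and> carre_dom D X X \<longrightarrow>
     (\<phi> \<circ> X \<in> D \<longrightarrow>
        (AE x in M. L (\<phi> \<circ> X) x =
           deriv \<phi> (X x) * L X x + deriv (deriv \<phi>) (X x) * carre_du_champ L X X x)) \<and>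
     (carre_dom D (\<phi> \<circ> X) X \<longrightarrow>
        (AE x in M. carre_du_champ L (\<phi> \<circ> X) X x = deriv \<phi> (X x) * carre_du_champ L X X x)) \<and>
     (carre_dom D (\<phi> \<circ> X) (\<phi> \<circ> X) \<longrightarrow>
        (AE x in M. carre_du_champ L (\<phi> \<circ> X) (\<phi> \<circ> X) x =
           (deriv \<phi> (X x))\<^sup>2 * carre_du_champ L X X x)))"

text \<open>The expressions do make sense for test functions of eigenfunctions.\<close>

definition stable_under_test_functions ::
    "'a measure \<Rightarrow> ('a \<Rightarrow> real) set \<Rightarrow> (('a \<Rightarrow> real) \<Rightarrow> 'a \<Rightarrow> real) \<Rightarrow> (nat \<Rightarrow> real) \<Rightarrow> bool" where
  "stable_under_test_functions M D L lam \<longleftrightarrow>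
     (\<forall>k. \<forall>X\<in>eigenspace M D L (lam k). \<forall>\<phi>. test_function \<phi> \<longrightarrow>
        carre_dom D (\<phi> \<circ> X) X \<and> carre_dom D (\<phi> \<circ> X) (\<phi> \<circ> X))"

definition hypercontractive ::
    "'a measure \<Rightarrow> ('a \<Rightarrow> real) set \<Rightarrow> (('a \<Rightarrow> real) \<Rightarrow> 'a \<Rightarrow> real) \<Rightarrow> (nat \<Rightarrow> real) \<Rightarrow> bool" where
  "hypercontractive M D L lam \<longleftrightarrow> (\<forall>k. \<forall>r::real. r \<ge> 2 \<longrightarrow>
     (\<exists>C. \<forall>X\<in>eigenspace M D L (lam k).
        integrable M (\<lambda>x. \<bar>X x\<bar> powr r) \<and>
        (\<integral>x. \<bar>X x\<bar> powr r \<partial>M) powr (1 / r) \<le> C * l2_norm M X))"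

definition chaos_eigenfunction ::
    "'a measure \<Rightarrow> ('a \<Rightarrow> real) set \<Rightarrow> (('a \<Rightarrow> real) \<Rightarrow> 'a \<Rightarrow> real) \<Rightarrow> (nat \<Rightarrow> real) \<Rightarrow>
     nat \<Rightarrow> ('a \<Rightarrow> real) \<Rightarrow> bool" where
  "chaos_eigenfunction M D L lam p X \<longleftrightarrow> X \<in> eigenspace M D L (lam p) \<and>
     (\<exists>W. (\<forall>k\<le>2*p. W k \<in> eigenspace M D L (lam k)) \<and>
        (AE x in M. (X x)\<^sup>2 = (\<Sum>k\<le>2*p. W k x)))"

definition moment :: "'a measure \<Rightarrow> nat \<Rightarrow> ('a \<Rightarrow> real) \<Rightarrow> real" where
  "moment M k X = (\<integral>x. X x ^ k \<partial>M)"

end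

theory Submission
  imports Defs
begin

text \<open>
  Write \<open>\<lambda>\<close> for \<open>lam p\<close>.  Translation does not change the carre du champ, so \<open>\<Gamma>(Y) = \<Gamma>(X)\<close>, and
  since \<open>L X = - \<lambda> X\<close> and \<open>L 1 = 0\<close> the integrand is the square of an image under \<open>L + 2\<lambda>\<close>:
  \<open>\<Gamma>(Y) - \<lambda> Y = (L + 2\<lambda>) V / 2\<close> with \<open>V = X\<^sup>2 - 2 X - \<nu>\<close>.
  The chaos hypothesis places \<open>V\<close> in the sum of the eigenspaces with indices \<open>k \<le> 2p\<close>.  On the
  \<open>k\<close>-th one \<open>L + 2\<lambda>\<close> acts as multiplication by \<open>2\<lambda> - lam k\<close>, a number in \<open>[0, 2\<lambda>]\<close> because
  \<open>0 \<le> lam k \<le> lam (2p) \<le> 2\<lambda>\<close>.  Numbers in that interval satisfy \<open>s\<^sup>2 \<le> 2\<lambda> s\<close>, so orthogonality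
  turns this into the quadratic form bound (\<open>square_le_form_on_eigenspace_sum\<close>)
  \<open>\<integral> (\<Gamma>(Y) - \<lambda> Y)\<^sup>2 \<le> \<lambda> \<integral> V (\<Gamma>(X) - \<lambda> X - \<lambda>\<nu>)\<close>.

  What is left is an explicit computation.  By diffusivity and integration by parts
  \<open>(n + 1) \<integral> X\<^sup>n \<Gamma>(X) = \<integral> \<Gamma>(X\<^bsup>n+1\<^esup>, X) = \<lambda> m\<^bsub>n+2\<^esub>(X)\<close> (\<open>integral_power_mult_carre_du_champ\<close>), and
  \<open>\<lambda> m\<^sub>1(X) = 0\<close>; inserting these on the right gives exactly the claimed combination of moments.
\<close>

section \<open>Square-integrable functions\<close>

lemma L2_measurable: "f \<in> L2 M \<Longrightarrow> f \<in> borel_measurable M"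
  by (simp add: L2_def)

lemma integrable_mult_L2:
  assumes "f \<in> L2 M" "g \<in> L2 M"
  shows "integrable M (\<lambda>x. f x * g x)"
proof (rule Bochner_Integration.integrable_bound)
  show "integrable M (\<lambda>x. (f x)\<^sup>2 + (g x)\<^sup>2)"
    using assms by (simp add: L2_def)
  show "(\<lambda>x. f x * g x) \<in> borel_measurable M"
    using assms by (auto simp: L2_def)
  have "\<bar>a * b\<bar> \<le> a\<^sup>2 + b\<^sup>2" for a b :: real
  proof -
    have "0 \<le> (\<bar>a\<bar> - \<bar>b\<bar>)\<^sup>2" by simp
    then have "2 * (\<bar>a\<bar> * \<bar>b\<bar>) \<le> a\<^sup>2 + b\<^sup>2"
      by (simp add: power2_diff)
    moreover have "0 \<le> \<bar>a\<bar> * \<bar>b\<bar>" by simp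
    ultimately show ?thesis unfolding abs_mult by linarith
  qed
  then show "AE x in M. norm (f x * g x) \<le> norm ((f x)\<^sup>2 + (g x)\<^sup>2)"
    by simp
qed

lemma L2_lincomb:
  assumes "f \<in> L2 M" "g \<in> L2 M"
  shows "(\<lambda>x. a * f x + b * g x) \<in> L2 M"
proof -
  have "integrable M (\<lambda>x. a\<^sup>2 * (f x)\<^sup>2 + (2 * a * b) * (f x * g x) + b\<^sup>2 * (g x)\<^sup>2)"
    using assms integrable_mult_L2[OF assms] by (simp add: L2_def)
  also have "(\<lambda>x. a\<^sup>2 * (f x)\<^sup>2 + (2 * a * b) * (f x * g x) + b\<^sup>2 * (g x)\<^sup>2)
      = (\<lambda>x. (a * f x + b * g x)\<^sup>2)"
    by (simp add: fun_eq_iff power2_eq_square algebra_simps)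
  finally show ?thesis using assms by (auto simp: L2_def)
qed

lemma integral_orthogonal_sums:
  fixes f :: "'i \<Rightarrow> 'a \<Rightarrow> real"
  assumes "finite I" and f: "\<And>i. i \<in> I \<Longrightarrow> f i \<in> L2 M"
    and orth: "\<And>i j. i \<in> I \<Longrightarrow> j \<in> I \<Longrightarrow> i \<noteq> j \<Longrightarrow> (\<integral>x. f i x * f j x \<partial>M) = 0"
  shows "(\<integral>x. (\<Sum>i\<in>I. a i * f i x) * (\<Sum>i\<in>I. b i * f i x) \<partial>M)
    = (\<Sum>i\<in>I. a i * b i * (\<integral>x. (f i x)\<^sup>2 \<partial>M))"
proof -
  have "(\<integral>x. (\<Sum>i\<in>I. a i * f i x) * (\<Sum>i\<in>I. b i * f i x) \<partial>M)
      = (\<integral>x. (\<Sum>i\<in>I. \<Sum>j\<in>I. a i * b j * (f i x * f j x)) \<partial>M)"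
    by (simp add: sum_product mult_ac)
  also have "\<dots> = (\<Sum>i\<in>I. \<Sum>j\<in>I. a i * b j * (\<integral>x. f i x * f j x \<partial>M))"
    using integrable_mult_L2[OF f f] by (simp add: Bochner_Integration.integral_sum)
  also have "\<dots> = (\<Sum>i\<in>I. \<Sum>j\<in>I. if j = i then a i * b i * (\<integral>x. (f i x)\<^sup>2 \<partial>M) else 0)"
    by (intro sum.cong refl) (auto simp: orth power2_eq_square)
  finally show ?thesis using \<open>finite I\<close> by simp
qed

section \<open>Operators and their eigenspaces\<close>

lemma l2_operator_lincomb:
  assumes "l2_operator M D L" "f \<in> D" "g \<in> D"
  shows "(\<lambda>x. a * f x + b * g x) \<in> D"
    and "AE x in M. L (\<lambda>x. a * f x + b * g x) x = a * L f x + b * L g x"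
  using assms unfolding l2_operator_def by blast+

lemma l2_operator_L2:
  assumes "l2_operator M D L" "f \<in> D"
  shows "f \<in> L2 M" "L f \<in> L2 M"
  using assms unfolding l2_operator_def by blast+

lemma l2_operator_cong_AE:
  assumes "l2_operator M D L" "f \<in> D" "g \<in> borel_measurable M" "AE x in M. f x = g x"
  shows "AE x in M. L f x = L g x"
  using assms unfolding l2_operator_def by blast

lemma carre_du_champ_measurable:
  assumes "l2_operator M D L" "carre_dom D f g"
  shows "carre_du_champ L f g \<in> borel_measurable M"
proof -
  have "f \<in> D" "g \<in> D" "(\<lambda>x. f x * g x) \<in> D"
    using assms(2) by (auto simp: carre_dom_def)
  note m = this[THEN l2_operator_L2(1)[OF assms(1)], THEN L2_measurable]
    this[THEN l2_operator_L2(2)[OF assms(1)], THEN L2_measurable]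
  show ?thesis
    unfolding carre_du_champ_def
    by (intro borel_measurable_divide borel_measurable_diff borel_measurable_times
        borel_measurable_const m)
qed

lemma l2_operator_sum:
  assumes op: "l2_operator M D L" and zero: "(\<lambda>_. 0) \<in> D"
    and "finite I" and "\<And>i. i \<in> I \<Longrightarrow> f i \<in> D"
  shows "(\<lambda>x. \<Sum>i\<in>I. f i x) \<in> D \<and> (AE x in M. L (\<lambda>x. \<Sum>i\<in>I. f i x) x = (\<Sum>i\<in>I. L (f i) x))"
  using assms(3,4)
proof (induction I rule: finite_induct)
  case empty
  then show ?case
    using zero l2_operator_lincomb(2)[OF op zero zero, of 0 0] by simp
next
  case (insert j I)
  then have j: "f j \<in> D" and S: "(\<lambda>x. \<Sum>i\<in>I. f i x) \<in> D"
    and AE: "AE x in M. L (\<lambda>x. \<Sum>i\<in>I. f i x) x = (\<Sum>i\<in>I. L (f i) x)"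
    by auto
  show ?case
    using l2_operator_lincomb[OF op j S, of 1 1] AE insert.hyps
    by auto
qed

lemma eigenspace_lincomb:
  assumes op: "l2_operator M D L"
    and f: "f \<in> eigenspace M D L r" and g: "g \<in> eigenspace M D L r"
  shows "(\<lambda>x. a * f x + b * g x) \<in> eigenspace M D L r"
proof -
  have fD: "f \<in> D" "g \<in> D" and AE: "AE x in M. L f x + r * f x = 0" "AE x in M. L g x + r * g x = 0"
    using f g by (auto simp: eigenspace_def)
  have "AE x in M. L (\<lambda>x. a * f x + b * g x) x + r * (a * f x + b * g x) = 0"
    using l2_operator_lincomb(2)[OF op fD, of a b] AE
  proof eventually_elim
    case (elim x)
    have "L (\<lambda>x. a * f x + b * g x) x + r * (a * f x + b * g x)
        = a * (L f x + r * f x) + b * (L g x + r * g x)"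
      unfolding elim(1) by (simp add: algebra_simps)
    then show ?case using elim by simp
  qed
  then show ?thesis
    using l2_operator_lincomb(1)[OF op fD] by (simp add: eigenspace_def)
qed

text \<open>
  In the coordinates given by the eigenspaces, \<open>L + c\<close> is multiplication by the numbers
  \<open>s = c - r i\<close>, which lie in \<open>[0, c]\<close>; the claim is \<open>s\<^sup>2 \<le> c s\<close>, weighted by the squared norms
  of the components.
\<close>

lemma square_le_form_on_eigenspace_sum:
  fixes W :: "'i \<Rightarrow> 'a \<Rightarrow> real"
  assumes op: "l2_operator M D L" and zero: "(\<lambda>_. 0) \<in> D" and "finite I"
    and W: "\<And>i. i \<in> I \<Longrightarrow> W i \<in> eigenspace M D L (r i)"
    and orth: "\<And>i j. i \<in> I \<Longrightarrow> j \<in> I \<Longrightarrow> i \<noteq> j \<Longrightarrow> (\<integral>x. W i x * W j x \<partial>M) = 0"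
    and r: "\<And>i. i \<in> I \<Longrightarrow> 0 \<le> r i \<and> r i \<le> c"
    and V: "V \<in> D" "AE x in M. V x = (\<Sum>i\<in>I. W i x)"
  shows "(\<integral>x. (L V x + c * V x)\<^sup>2 \<partial>M) \<le> c * (\<integral>x. V x * (L V x + c * V x) \<partial>M)"
proof -
  have WD: "W i \<in> D" and WL: "AE x in M. L (W i) x = - (r i * W i x)" if "i \<in> I" for i
    using W[OF that] by (auto simp: eigenspace_def add_eq_0_iff2)
  have W2: "W i \<in> L2 M" if "i \<in> I" for i
    using l2_operator_L2[OF op WD[OF that]] by simp
  have SD: "(\<lambda>x. \<Sum>i\<in>I. W i x) \<in> D"
    and SL: "AE x in M. L (\<lambda>x. \<Sum>i\<in>I. W i x) x = (\<Sum>i\<in>I. L (W i) x)"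
    using l2_operator_sum[OF op zero \<open>finite I\<close>, of W] WD by auto
  have "AE x in M. L V x = L (\<lambda>x. \<Sum>i\<in>I. W i x) x"
    by (rule l2_operator_cong_AE[OF op V(1) L2_measurable[OF l2_operator_L2(1)[OF op SD]] V(2)])
  moreover have "AE x in M. \<forall>i\<in>I. L (W i) x = - (r i * W i x)"
    using WL \<open>finite I\<close> by (simp add: AE_finite_all)
  ultimately have T: "AE x in M. L V x + c * V x = (\<Sum>i\<in>I. (c - r i) * W i x)"
    using SL V(2)
  proof eventually_elim
    case (elim x)
    then show ?case
      by (simp add: left_diff_distrib sum_subtractf sum_distrib_left sum_negf)
  qed
  note meas = L2_measurable[OF l2_operator_L2(1)[OF op V(1)]] L2_measurable[OF l2_operator_L2(2)[OF op V(1)]]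
    and measW = L2_measurable[OF W2]
  have "(\<integral>x. (L V x + c * V x)\<^sup>2 \<partial>M)
      = (\<integral>x. (\<Sum>i\<in>I. (c - r i) * W i x) * (\<Sum>i\<in>I. (c - r i) * W i x) \<partial>M)"
    using T meas measW
    by (intro integral_cong_AE) (auto simp: power2_eq_square intro!: borel_measurable_sum)
  also have "\<dots> = (\<Sum>i\<in>I. (c - r i) * (c - r i) * (\<integral>x. (W i x)\<^sup>2 \<partial>M))"
    using integral_orthogonal_sums[OF \<open>finite I\<close> W2 orth] .
  also have "\<dots> \<le> (\<Sum>i\<in>I. c * (c - r i) * (\<integral>x. (W i x)\<^sup>2 \<partial>M))"
    using r by (intro sum_mono mult_right_mono) auto
  also have "\<dots> = c * (\<Sum>i\<in>I. 1 * (c - r i) * (\<integral>x. (W i x)\<^sup>2 \<partial>M))"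
    by (simp add: sum_distrib_left mult_ac)
  also have "(\<Sum>i\<in>I. 1 * (c - r i) * (\<integral>x. (W i x)\<^sup>2 \<partial>M))
      = (\<integral>x. (\<Sum>i\<in>I. 1 * W i x) * (\<Sum>i\<in>I. (c - r i) * W i x) \<partial>M)"
    using integral_orthogonal_sums[OF \<open>finite I\<close> W2 orth, where a = "\<lambda>_. 1"] by simp
  also have "\<dots> = (\<integral>x. V x * (L V x + c * V x) \<partial>M)"
    using T V(2) meas measW
    by (intro integral_cong_AE) (auto intro!: borel_measurable_sum)
  finally show ?thesis .
qed

section \<open>Powers of eigenfunctions\<close>

lemma smooth_poly: "smooth (poly q)" for q :: "real poly"
proof -
  have "(deriv ^^ n) (poly q) = poly ((pderiv ^^ n) q)" for n
    by (induction n) (auto intro!: DERIV_imp_deriv poly_DERIV)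
  then show ?thesis by (simp add: smooth_def)
qed

lemma power_eq_poly_monom: "(\<lambda>t::real. t ^ n) = poly (monom 1 n)"
  by (simp add: fun_eq_iff poly_monom)

lemma carre_dom_power_eigenfunction:
  assumes "stable_under_test_functions M D L lam" "X \<in> eigenspace M D L (lam k)"
  shows "carre_dom D (\<lambda>x. X x ^ n) X"
proof -
  have "test_function (\<lambda>t::real. t ^ n)"
    by (simp add: test_function_def power_eq_poly_monom)
  then show ?thesis
    using assms unfolding stable_under_test_functions_def
    by (auto simp: comp_def)
qed

text \<open>
  \<open>(n + 1) X\<^sup>n \<Gamma>(X) = \<Gamma>(X\<^bsup>n+1\<^esup>, X)\<close> by diffusivity, and integration by parts moves the generator to
  the factor \<open>X\<close>, where it is multiplication by \<open>- lam k\<close>.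
\<close>

lemma integral_power_mult_carre_du_champ:
  assumes op: "l2_operator M D L" and "integration_by_parts M D L" and "diffusive M D L"
    and stable: "stable_under_test_functions M D L lam"
    and X: "X \<in> eigenspace M D L (lam k)"
  shows "(n + 1) * (\<integral>x. X x ^ n * carre_du_champ L X X x \<partial>M) = lam k * moment M (n + 2) X"
proof -
  have dom: "carre_dom D (\<lambda>x. X x ^ i) X" for i
    by (rule carre_dom_power_eigenfunction[OF stable X])
  have XX: "carre_dom D X X"
    using dom[of 1] by simp
  have XD: "X \<in> D" and LX: "AE x in M. L X x = - (lam k * X x)"
    using X by (auto simp: eigenspace_def add_eq_0_iff2)
  note [measurable] = carre_du_champ_measurable[OF op dom] carre_du_champ_measurable[OF op XX]
    L2_measurable[OF l2_operator_L2(1)[OF op XD]] L2_measurable[OF l2_operator_L2(2)[OF op XD]]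
  have "deriv (\<lambda>t. t ^ Suc n) t = (n + 1) * t ^ n" for t :: real
    by (rule DERIV_imp_deriv) (use DERIV_pow[of "Suc n" t] in simp)
  moreover have "smooth (\<lambda>t. t ^ Suc n)"
    unfolding power_eq_poly_monom by (rule smooth_poly)
  then have "AE x in M. carre_du_champ L ((\<lambda>t. t ^ Suc n) \<circ> X) X x
      = deriv (\<lambda>t. t ^ Suc n) (X x) * carre_du_champ L X X x"
    using \<open>diffusive M D L\<close>[unfolded diffusive_def, rule_format, of "\<lambda>t. t ^ Suc n" X]
      XX dom[of "Suc n"] by (simp only: comp_def simp_thms)
  ultimately have "AE x in M. carre_du_champ L (\<lambda>x. X x ^ Suc n) X x
      = (n + 1) * X x ^ n * carre_du_champ L X X x"
    by (simp only: comp_def)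
  then have "(\<integral>x. carre_du_champ L (\<lambda>x. X x ^ Suc n) X x \<partial>M)
      = (\<integral>x. (n + 1) * X x ^ n * carre_du_champ L X X x \<partial>M)"
    by (intro integral_cong_AE carre_du_champ_measurable[OF op dom]) measurable
  moreover have "(\<integral>x. carre_du_champ L (\<lambda>x. X x ^ Suc n) X x \<partial>M) = - (\<integral>x. X x ^ Suc n * L X x \<partial>M)"
    using \<open>integration_by_parts M D L\<close> dom[of "Suc n"] unfolding integration_by_parts_def by blast
  moreover have "(\<integral>x. X x ^ Suc n * L X x \<partial>M) = (\<integral>x. - lam k * X x ^ (n + 2) \<partial>M)"
    using LX by (intro integral_cong_AE) (auto simp: algebra_simps)
  ultimately show ?thesis
    by (simp add: moment_def mult.assoc add.commute)
qed

text \<open>The eigenvalue factor makes this hold for constant \<open>X\<close> as well, when the eigenvalue is zero.\<close>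

lemma eigenvalue_mult_mean:
  assumes op: "l2_operator M D L" and "annihilates_one M D L" and "integration_by_parts M D L"
    and X: "X \<in> eigenspace M D L r"
  shows "r * (\<integral>x. X x \<partial>M) = 0"
proof -
  have XD: "X \<in> D" and LX: "AE x in M. L X x = - (r * X x)"
    using X by (auto simp: eigenspace_def add_eq_0_iff2)
  have one: "(\<lambda>_. 1) \<in> D" and L1: "AE x in M. L (\<lambda>_. 1) x = 0"
    using \<open>annihilates_one M D L\<close> by (auto simp: annihilates_one_def)
  note [measurable] = L2_measurable[OF l2_operator_L2(1)[OF op XD]]
    L2_measurable[OF l2_operator_L2(2)[OF op XD]] L2_measurable[OF l2_operator_L2(2)[OF op one]]
  have "carre_dom D X (\<lambda>_. 1)"
    using XD one by (simp add: carre_dom_def)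
  then have "(\<integral>x. X x * L (\<lambda>_. 1) x \<partial>M) = (\<integral>x. 1 * L X x \<partial>M)"
    using \<open>integration_by_parts M D L\<close> unfolding integration_by_parts_def by force
  moreover have "(\<integral>x. X x * L (\<lambda>_. 1) x \<partial>M) = (\<integral>x. 0 \<partial>M)"
    using L1 by (intro integral_cong_AE) auto
  moreover have "(\<integral>x. 1 * L X x \<partial>M) = (\<integral>x. - r * X x \<partial>M)"
    using LX by (intro integral_cong_AE) auto
  ultimately show ?thesis by simp
qed

section \<open>The fourth moment bound\<close>

theorem theorem3p4:
  fixes M :: "'a measure"
    and D :: "('a \<Rightarrow> real) set"
    and L :: "('a \<Rightarrow> real) \<Rightarrow> 'a \<Rightarrow> real"
    and lam :: "nat \<Rightarrow> real"
    and p :: nat and X Y :: "'a \<Rightarrow> real" and \<nu> :: real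
  assumes "prob_space M"
    and "self_adjoint_operator M D L"
    and "annihilates_one M D L"
    and "has_discrete_spectrum M D L lam"
    and "integration_by_parts M D L"
    and "diffusive M D L"
    and "stable_under_test_functions M D L lam"
    and "hypercontractive M D L lam"
    and "chaos_eigenfunction M D L lam p X"
    and "lam (2 * p) \<le> 2 * lam p"
    and "\<nu> > 0"
    and "Y = (\<lambda>x. X x + \<nu>)"
  shows "(\<integral>x. (carre_du_champ L Y Y x - lam p * Y x)\<^sup>2 \<partial>M)
    \<le> (lam p)\<^sup>2 / 3 *
      (moment M 4 X - 6 * moment M 3 X + 6 * (1 - \<nu>) * moment M 2 X + 3 * \<nu>\<^sup>2)"
proof -
  interpret prob_space M by fact
  define l where "l = lam p"
  have op: "l2_operator M D L"
    using assms(2) by (simp add: self_adjoint_operator_def)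
  have one: "(\<lambda>_. 1) \<in> D" and L1: "AE x in M. L (\<lambda>_. 1) x = 0"
    using assms(3) by (auto simp: annihilates_one_def)
  have zero: "(\<lambda>_. 0) \<in> D"
    using l2_operator_lincomb(1)[OF op one one, of 0 0] by simp
  have lam0: "lam 0 = 0" and mono: "strict_mono lam"
    and orth: "orthogonal_decomposition M D L lam"
    using assms(4) by (auto simp: has_discrete_spectrum_def)
  obtain W where X: "X \<in> eigenspace M D L (lam p)"
    and W: "\<And>k. k \<le> 2 * p \<Longrightarrow> W k \<in> eigenspace M D L (lam k)"
    and XW: "AE x in M. (X x)\<^sup>2 = (\<Sum>k\<le>2*p. W k x)"
    using assms(9) by (auto simp: chaos_eigenfunction_def)
  have XD: "X \<in> D" and LX: "AE x in M. L X x = - (l * X x)"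
    using X by (auto simp: eigenspace_def add_eq_0_iff2 l_def)
  have sqD: "(\<lambda>x. (X x)\<^sup>2) \<in> D"
    using carre_dom_power_eigenfunction[OF assms(7) X, of 2] by (simp add: carre_dom_def)
  define V where "V = (\<lambda>x. (X x)\<^sup>2 - 2 * X x - \<nu>)"
  define G where "G = (\<lambda>x. carre_du_champ L X X x - l * X x - l * \<nu>)"

  have quadD: "(\<lambda>x. (X x)\<^sup>2 + a * X x + b) \<in> D"
    and quadL: "AE x in M. L (\<lambda>x. (X x)\<^sup>2 + a * X x + b) x = L (\<lambda>x. (X x)\<^sup>2) x - a * l * X x"
    for a b
  proof -
    note in1 = l2_operator_lincomb[OF op XD one, of a b]
    note in2 = l2_operator_lincomb[OF op sqD in1(1), of 1 1]
    show "(\<lambda>x. (X x)\<^sup>2 + a * X x + b) \<in> D"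
      using in2(1) by (simp add: add.assoc)
    have "AE x in M. L (\<lambda>x. 1 * (X x)\<^sup>2 + 1 * (a * X x + b * 1)) x
        = L (\<lambda>x. (X x)\<^sup>2) x - a * l * X x"
      using in1(2) in2(2) LX L1 by eventually_elim simp
    then show "AE x in M. L (\<lambda>x. (X x)\<^sup>2 + a * X x + b) x = L (\<lambda>x. (X x)\<^sup>2) x - a * l * X x"
      by (simp add: add.assoc)
  qed
  have VD: "V \<in> D" and LV: "AE x in M. L V x = L (\<lambda>x. (X x)\<^sup>2) x + 2 * l * X x"
    using quadD[of "-2" "-\<nu>"] quadL[of "-2" "-\<nu>"] by (simp_all add: V_def)

  have gamma: "AE x in M. carre_du_champ L X X x = L (\<lambda>x. (X x)\<^sup>2) x / 2 + l * (X x)\<^sup>2"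
    using LX by eventually_elim (simp add: carre_du_champ_def power2_eq_square field_simps)
  have YD: "Y \<in> D" and LY: "AE x in M. L Y x = - (l * X x)"
  proof -
    note lin = l2_operator_lincomb[OF op XD one, of 1 \<nu>]
    show "Y \<in> D" using lin(1) by (simp add: assms(12))
    have "AE x in M. L (\<lambda>x. 1 * X x + \<nu> * 1) x = - (l * X x)"
      using lin(2) LX L1 by eventually_elim simp
    then show "AE x in M. L Y x = - (l * X x)" by (simp add: assms(12))
  qed
  have sqY: "(\<lambda>x. Y x * Y x) = (\<lambda>x. (X x)\<^sup>2 + (2 * \<nu>) * X x + \<nu>\<^sup>2)"
    by (simp add: assms(12) fun_eq_iff power2_eq_square algebra_simps)
  have gammaY: "AE x in M. carre_du_champ L Y Y x = carre_du_champ L X X x"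
    using gamma LY quadL[of "2 * \<nu>" "\<nu>\<^sup>2"] unfolding sqY[symmetric]
    by eventually_elim (simp add: carre_du_champ_def assms(12) power2_eq_square field_simps)
  have GV: "AE x in M. L V x + 2 * l * V x = 2 * G x"
    using gamma LV by eventually_elim (simp add: G_def V_def field_simps)

  have sqL2: "(\<lambda>x. (X x)\<^sup>2) \<in> L2 M" and XL2: "X \<in> L2 M" and oneL2: "(\<lambda>_. 1) \<in> L2 M"
    and LsqL2: "L (\<lambda>x. (X x)\<^sup>2) \<in> L2 M"
    using l2_operator_L2[OF op] sqD XD one by blast+
  note [measurable] = L2_measurable[OF XL2] L2_measurable[OF LsqL2]
    L2_measurable[OF l2_operator_L2(2)[OF op XD]] L2_measurable[OF l2_operator_L2(2)[OF op YD]]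
    L2_measurable[OF l2_operator_L2(1)[OF op YD]]
    L2_measurable[OF l2_operator_L2(2)[OF op VD]] L2_measurable[OF l2_operator_L2(1)[OF op VD]]
  have "carre_dom D X X" "carre_dom D Y Y"
    using XD YD sqD quadD unfolding carre_dom_def sqY power2_eq_square by auto
  note [measurable] = this[THEN carre_du_champ_measurable[OF op]]
  have [measurable]: "G \<in> borel_measurable M"
    unfolding G_def by measurable

  \<comment> \<open>The components of \<open>V\<close> are those of \<open>X\<^sup>2\<close>, corrected by \<open>- 2 X\<close> at the index \<open>p\<close> and by \<open>- \<nu>\<close> at
    the index \<open>0\<close>; the two corrections are added up because \<open>p\<close> may be \<open>0\<close>.\<close>
  define U where "U = (\<lambda>k x. W k x - 2 * (if k = p then X x else 0) - \<nu> * (if k = 0 then 1 else 0))"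
  have zeroE: "(\<lambda>_. 0) \<in> eigenspace M D L (lam k)" if "k \<le> 2 * p" for k
    using eigenspace_lincomb[OF op W[OF that] W[OF that], of 0 0] by simp
  have oneE: "(\<lambda>_. 1) \<in> eigenspace M D L (lam 0)"
    using one L1 lam0 by (simp add: eigenspace_def)
  have U: "U k \<in> eigenspace M D L (lam k)" if "k \<le> 2 * p" for k
  proof -
    have "(\<lambda>x. if k = p then X x else 0) \<in> eigenspace M D L (lam k)"
      using X zeroE[OF that] by (cases "k = p") simp_all
    then have *: "(\<lambda>x. 1 * W k x + (-2) * (if k = p then X x else 0)) \<in> eigenspace M D L (lam k)"
      by (rule eigenspace_lincomb[OF op W[OF that]])
    have "(\<lambda>x. if k = 0 then 1 else 0) \<in> eigenspace M D L (lam k)"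
      using oneE zeroE[OF that] by (cases "k = 0") simp_all
    then have "(\<lambda>x. 1 * (1 * W k x + (-2) * (if k = p then X x else 0))
        + (-\<nu>) * (if k = 0 then 1 else 0)) \<in> eigenspace M D L (lam k)"
      by (rule eigenspace_lincomb[OF op *])
    then show ?thesis by (simp add: U_def)
  qed
  have VU: "AE x in M. V x = (\<Sum>k\<le>2*p. U k x)"
    using XW by eventually_elim
      (simp add: V_def U_def sum_subtractf flip: sum_distrib_left)
  have lam_bounds: "0 \<le> lam k \<and> lam k \<le> 2 * l" if "k \<le> 2 * p" for k
    using strict_mono_less_eq[OF mono, of 0 k] strict_mono_less_eq[OF mono, of k "2 * p"]
      lam0 that assms(10) by (simp add: l_def)
  have U_orth: "(\<integral>x. U i x * U j x \<partial>M) = 0" if "i \<le> 2 * p" "j \<le> 2 * p" "i \<noteq> j" for i j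
    using orth U that unfolding orthogonal_decomposition_def by blast

  have form: "(\<integral>x. (L V x + 2 * l * V x)\<^sup>2 \<partial>M) \<le> 2 * l * (\<integral>x. V x * (L V x + 2 * l * V x) \<partial>M)"
    by (rule square_le_form_on_eigenspace_sum[OF op zero _ _ _ _ VD VU, where r = lam])
      (use U U_orth lam_bounds in auto)
  have "(\<integral>x. (L V x + 2 * l * V x)\<^sup>2 \<partial>M) = (\<integral>x. 4 * (G x)\<^sup>2 \<partial>M)"
    using GV by (intro integral_cong_AE) (auto simp: power_mult_distrib)
  moreover have "(\<integral>x. V x * (L V x + 2 * l * V x) \<partial>M) = (\<integral>x. 2 * (V x * G x) \<partial>M)"
    using GV by (intro integral_cong_AE) auto
  ultimately have bound: "(\<integral>x. (G x)\<^sup>2 \<partial>M) \<le> l * (\<integral>x. V x * G x \<partial>M)"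
    using form by simp

  \<comment> \<open>\<open>\<Gamma>(X)\<close> coincides almost everywhere with an \<open>L\<^sup>2\<close> function, which makes its products with
    \<open>1\<close>, \<open>X\<close> and \<open>X\<^sup>2\<close> integrable.\<close>
  define g where "g = (\<lambda>x. 1 / 2 * L (\<lambda>x. (X x)\<^sup>2) x + l * (X x)\<^sup>2)"
  have gL2: "g \<in> L2 M"
    unfolding g_def by (rule L2_lincomb[OF LsqL2 sqL2])
  have gammag: "AE x in M. g x = carre_du_champ L X X x"
    using gamma by eventually_elim (simp add: g_def)
  note [measurable] = L2_measurable[OF gL2]
  have int: "integrable M (\<lambda>x. f x * carre_du_champ L X X x)" if "f \<in> L2 M" for f
  proof -
    note [measurable] = L2_measurable[OF that]
    show ?thesis
      using gammag by (intro integrable_cong_AE_imp[OF integrable_mult_L2[OF that gL2]]) auto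
  qed
  have int0: "integrable M (carre_du_champ L X X)"
    and int1: "integrable M (\<lambda>x. X x * carre_du_champ L X X x)"
    and int2: "integrable M (\<lambda>x. (X x)\<^sup>2 * carre_du_champ L X X x)"
    using int[OF oneL2] int[OF XL2] int[OF sqL2] by simp_all
  have intX: "integrable M X" "integrable M (\<lambda>x. (X x)\<^sup>2)" "integrable M (\<lambda>x. X x ^ 3)"
    using integrable_mult_L2[OF XL2 oneL2] integrable_mult_L2[OF XL2 XL2]
      integrable_mult_L2[OF XL2 sqL2] by (simp_all add: power2_eq_square power3_eq_cube mult.assoc)
  note parts = integral_power_mult_carre_du_champ[OF op assms(5,6,7) X]
  have parts0: "(\<integral>x. carre_du_champ L X X x \<partial>M) = l * moment M 2 X"
    and parts1: "2 * (\<integral>x. X x * carre_du_champ L X X x \<partial>M) = l * moment M 3 X"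
    and parts2: "3 * (\<integral>x. (X x)\<^sup>2 * carre_du_champ L X X x \<partial>M) = l * moment M 4 X"
    using parts[of 0] parts[of 1] parts[of 2]
    by (simp_all add: l_def numeral_eq_Suc)
  have mean: "l * (\<integral>x. X x \<partial>M) = 0"
    unfolding l_def by (rule eigenvalue_mult_mean[OF op assms(3,5) X])

  have "(\<integral>x. V x * G x \<partial>M) = (\<integral>x. (X x)\<^sup>2 * carre_du_champ L X X x
      - 2 * (X x * carre_du_champ L X X x) - \<nu> * carre_du_champ L X X x
      - l * X x ^ 3 + (2 * l - l * \<nu>) * (X x)\<^sup>2 + 3 * \<nu> * (l * X x) + l * \<nu>\<^sup>2 \<partial>M)"
    by (intro Bochner_Integration.integral_cong refl)
      (simp add: V_def G_def power2_eq_square power3_eq_cube algebra_simps)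
  also have "\<dots> = (\<integral>x. (X x)\<^sup>2 * carre_du_champ L X X x \<partial>M)
      - 2 * (\<integral>x. X x * carre_du_champ L X X x \<partial>M) - \<nu> * (\<integral>x. carre_du_champ L X X x \<partial>M)
      - l * moment M 3 X + (2 * l - l * \<nu>) * moment M 2 X + 3 * \<nu> * (l * (\<integral>x. X x \<partial>M)) + l * \<nu>\<^sup>2"
    using int0 int1 int2 intX by (simp add: moment_def prob_space)
  also have "\<dots> = l / 3 *
      (moment M 4 X - 6 * moment M 3 X + 6 * (1 - \<nu>) * moment M 2 X + 3 * \<nu>\<^sup>2)"
    using parts0 parts1 parts2 mean by (simp add: algebra_simps)
  finally have VG: "(\<integral>x. V x * G x \<partial>M) = l / 3 *
      (moment M 4 X - 6 * moment M 3 X + 6 * (1 - \<nu>) * moment M 2 X + 3 * \<nu>\<^sup>2)" .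

  have "(\<integral>x. (carre_du_champ L Y Y x - lam p * Y x)\<^sup>2 \<partial>M) = (\<integral>x. (G x)\<^sup>2 \<partial>M)"
    using gammaY by (intro integral_cong_AE) (measurable, auto simp: G_def l_def assms(12) algebra_simps)
  also note bound
  finally show ?thesis
    unfolding VG by (simp add: l_def power2_eq_square mult_ac)
qed

end
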